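(* Let $B$ be a derivation-finite algebra over a field $\mathbf{k}$ and let $\mathscr{L}$ be a Lie subalgebra of $\operatorname{Der}_{\mathbf{k}}(B)$ such that $\mathscr{L}\subseteq\operatorname{LFD}_{\mathbf{k}}(B)$. (a) If there exists $n\in\mathbb{N}$ such that $\mathscr{L}^{(n)}$ is weakly locally finite, then $\mathscr{L}$ is weakly locally finite. (b) If $\mathscr{L}$ is solvable, then it is weakly locally finite.
   Context: An algebra over a field $\mathbf{k}$ is a $\mathbf{k}$-vector space $B$ together with an arbitrary $\mathbf{k}$-bilinear map $B\times B\to B$, $(x,y)\mapsto x\cdot y$ (not assumed commutative, associative or unital). A $\mathbf{k}$-derivation of $B$ is a $\mathbf{k}$-linear map $D:B\to B$ with $D(x\cdot y)=D(x)\cdot y+x\cdot D(y)$ for all $x,y\in B$. The set $\operatorname{Der}_{\mathbf{k}}(B)$ of all $\mathbf{k}$-derivations of $B$ is a Lie algebra over $\mathbf{k}$ with bracket $[D,E]=D\circ E-E\circ D$. $B$ is derivation-finite if there exists a finite subset $F$ of $B$ such that the only $D\in\operatorname{Der}_{\mathbf{k}}(B)$ satisfying $D(x)=0$ for all $x\in F$ is $D=0$. A subset $\Delta$ of $\operatorname{Der}_{\mathbf{k}}(B)$ is locally finite if for each $b\in B$ there exists a finite dimensional $\mathbf{k}$-linear subspace $U$ of $B$ such that $b\in U$ and $D(U)\subseteq U$ for all $D\in\Delta$. It is weakly locally finite if every finite subset of $\Delta$ is locally finite. A derivation $D\in\operatorname{Der}_{\mathbf{k}}(B)$ is locally finite if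 $\{D\}$ is a locally finite set; $\operatorname{LFD}_{\mathbf{k}}(B)$ denotes the set of locally finite $\mathbf{k}$-derivations of $B$. For a Lie algebra $\mathscr{L}$, $\mathscr{L}'$ denotes the Lie subalgebra of $\mathscr{L}$ generated by $\{[x,y]\mid x,y\in\mathscr{L}\}$; $\mathscr{L}^{(0)}=\mathscr{L}$ and $\mathscr{L}^{(n+1)}=(\mathscr{L}^{(n)})'$ for $n\ge 0$. $\mathscr{L}$ is solvable if $\mathscr{L}^{(d)}=0$ for some $d\in\mathbb{N}$. $\mathbb{N}$ includes $0$. *)

theory Defs
  imports Complex_Main
begin

text \<open>Algebras over a field: the product is an arbitrary bilinear map, with no commutativity,
  associativity or unit assumed.\<close>

locale nonassoc_algebra = vector_space scale
  for scale :: "'k::field \<Rightarrow> 'b::ab_group_add \<Rightarrow> 'b" (infixr \<open>*s\<close> 75) +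
  fixes mult :: "'b \<Rightarrow> 'b \<Rightarrow> 'b" (infixl \<open>\<cdot>\<close> 70)
  assumes linear_mult_left: "Vector_Spaces.linear scale scale (\<lambda>x. x \<cdot> y)"
    and linear_mult_right: "Vector_Spaces.linear scale scale (\<lambda>y. x \<cdot> y)"
begin

definition Der :: "('b \<Rightarrow> 'b) set" where
  "Der = {D. Vector_Spaces.linear scale scale D \<and> (\<forall>x y. D (x \<cdot> y) = D x \<cdot> y + x \<cdot> D y)}"

definition derivation_finite :: bool where
  "derivation_finite \<longleftrightarrow>
     (\<exists>F. finite F \<and> (\<forall>D\<in>Der. (\<forall>x\<in>F. D x = 0) \<longrightarrow> D = (\<lambda>_. 0)))"

text \<open>Finite dimension is stated by a finite spanning set, because \<^term>\<open>dim\<close> is \<^term>\<open>0 :: nat\<close>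
  on infinite-dimensional subspaces.\<close>

definition finite_dim_subspace :: "'b set \<Rightarrow> bool" where
  "finite_dim_subspace U \<longleftrightarrow> subspace U \<and> (\<exists>S. finite S \<and> span S = U)"

definition locally_finite :: "('b \<Rightarrow> 'b) set \<Rightarrow> bool" where
  "locally_finite \<Delta> \<longleftrightarrow>
     (\<forall>b. \<exists>U. finite_dim_subspace U \<and> b \<in> U \<and> (\<forall>D\<in>\<Delta>. D ` U \<subseteq> U))"

definition weakly_locally_finite :: "('b \<Rightarrow> 'b) set \<Rightarrow> bool" where
  "weakly_locally_finite \<Delta> \<longleftrightarrow> (\<forall>F. finite F \<and> F \<subseteq> \<Delta> \<longrightarrow> locally_finite F)"

definition LFD :: "('b \<Rightarrow> 'b) set" where
  "LFD = {D \<in> Der. locally_finite {D}}"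

definition lie_bracket :: "('b \<Rightarrow> 'b) \<Rightarrow> ('b \<Rightarrow> 'b) \<Rightarrow> 'b \<Rightarrow> 'b" where
  "lie_bracket D E = (\<lambda>x. (D \<circ> E) x - (E \<circ> D) x)"

text \<open>Lie subalgebras of \<^term>\<open>Der\<close>, with the pointwise vector space structure.\<close>

definition lie_subalgebra :: "('b \<Rightarrow> 'b) set \<Rightarrow> bool" where
  "lie_subalgebra L \<longleftrightarrow> L \<subseteq> Der \<and> (\<lambda>_. 0) \<in> L
     \<and> (\<forall>D\<in>L. \<forall>E\<in>L. (\<lambda>x. D x + E x) \<in> L)
     \<and> (\<forall>c. \<forall>D\<in>L. (\<lambda>x. c *s D x) \<in> L)
     \<and> (\<forall>D\<in>L. \<forall>E\<in>L. lie_bracket D E \<in> L)"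

definition derived_algebra :: "('b \<Rightarrow> 'b) set \<Rightarrow> ('b \<Rightarrow> 'b) set" where
  "derived_algebra L =
     (\<lambda>M. lie_subalgebra M \<and> M \<subseteq> L) hull {lie_bracket D E | D E. D \<in> L \<and> E \<in> L}"

primrec derived_series :: "('b \<Rightarrow> 'b) set \<Rightarrow> nat \<Rightarrow> ('b \<Rightarrow> 'b) set" where
  "derived_series L 0 = L"
| "derived_series L (Suc n) = derived_algebra (derived_series L n)"

definition lie_solvable :: "('b \<Rightarrow> 'b) set \<Rightarrow> bool" where
  "lie_solvable L \<longleftrightarrow> (\<exists>d. derived_series L d = {\<lambda>_. 0})"

lemma mult_simps:
  "(x + y) \<cdot> z = x \<cdot> z + y \<cdot> z" "z \<cdot> (x + y) = z \<cdot> x + z \<cdot> y"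
  "(x - y) \<cdot> z = x \<cdot> z - y \<cdot> z" "z \<cdot> (x - y) = z \<cdot> x - z \<cdot> y"
  "(c *s x) \<cdot> z = c *s (x \<cdot> z)" "z \<cdot> (c *s x) = c *s (z \<cdot> x)"
  "0 \<cdot> z = 0" "z \<cdot> 0 = 0"
proof -
  interpret l: Vector_Spaces.linear scale scale "\<lambda>x. x \<cdot> z" by (rule linear_mult_left)
  interpret r: Vector_Spaces.linear scale scale "\<lambda>x. z \<cdot> x" by (rule linear_mult_right)
  show "(x + y) \<cdot> z = x \<cdot> z + y \<cdot> z" "z \<cdot> (x + y) = z \<cdot> x + z \<cdot> y"
    "(x - y) \<cdot> z = x \<cdot> z - y \<cdot> z" "z \<cdot> (x - y) = z \<cdot> x - z \<cdot> y"
    "(c *s x) \<cdot> z = c *s (x \<cdot> z)" "z \<cdot> (c *s x) = c *s (z \<cdot> x)"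
    "0 \<cdot> z = 0" "z \<cdot> 0 = 0"
    by (rule l.add r.add l.diff r.diff l.scale r.scale l.zero r.zero)+
qed

lemma Der_iff:
  "D \<in> Der \<longleftrightarrow> (\<forall>x y. D (x + y) = D x + D y) \<and> (\<forall>c x. D (c *s x) = c *s D x)
     \<and> (\<forall>x y. D (x \<cdot> y) = D x \<cdot> y + x \<cdot> D y)"
  by (auto simp: Der_def Vector_Spaces.linear_iff vector_space_axioms)

lemma DerD:
  assumes "D \<in> Der"
  shows "D (x + y) = D x + D y" "D (x - y) = D x - D y" "D (c *s x) = c *s D x" "D 0 = 0"
    "D (x \<cdot> y) = D x \<cdot> y + x \<cdot> D y"
proof -
  interpret D: Vector_Spaces.linear scale scale D using assms by (simp add: Der_def)
  show "D (x + y) = D x + D y" "D (x - y) = D x - D y" "D (c *s x) = c *s D x" "D 0 = 0"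
    by (rule D.add D.diff D.scale D.zero)+
  show "D (x \<cdot> y) = D x \<cdot> y + x \<cdot> D y" using assms by (simp add: Der_def)
qed

lemma lie_subalgebra_Der: "lie_subalgebra Der"
  unfolding lie_subalgebra_def
proof (intro conjI ballI allI)
  show "(\<lambda>_. 0) \<in> Der" by (simp add: Der_iff mult_simps)
next
  fix D E assume "D \<in> Der" "E \<in> Der"
  note DE = DerD[OF this(1)] DerD[OF this(2)]
  show "(\<lambda>x. D x + E x) \<in> Der"
    by (simp add: Der_iff DE mult_simps scale_right_distrib ac_simps)
  show "lie_bracket D E \<in> Der"
    by (simp add: Der_iff lie_bracket_def DE mult_simps scale_right_diff_distrib)
next
  fix c D assume "D \<in> Der"
  note D = DerD[OF this]
  show "(\<lambda>x. c *s D x) \<in> Der"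
    by (simp add: Der_iff D mult_simps scale_right_distrib mult.commute)
qed simp

lemma lie_subalgebra_Inter:
  assumes "\<And>M. M \<in> \<M> \<Longrightarrow> lie_subalgebra M" and "\<M> \<noteq> {}"
  shows "lie_subalgebra (\<Inter>\<M>)"
proof -
  have "M \<subseteq> Der" if "M \<in> \<M>" for M
    using assms(1)[OF that] by (simp add: lie_subalgebra_def)
  then have "\<Inter>\<M> \<subseteq> Der" using \<open>\<M> \<noteq> {}\<close> by blast
  moreover have "(\<lambda>_. 0) \<in> M \<and> (\<forall>D\<in>M. \<forall>E\<in>M. (\<lambda>x. D x + E x) \<in> M)
      \<and> (\<forall>c. \<forall>D\<in>M. (\<lambda>x. c *s D x) \<in> M) \<and> (\<forall>D\<in>M. \<forall>E\<in>M. lie_bracket D E \<in> M)"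
    if "M \<in> \<M>" for M using assms(1)[OF that] by (simp add: lie_subalgebra_def)
  ultimately show ?thesis unfolding lie_subalgebra_def by simp
qed

lemma derived_algebra_lie_subalgebra:
  assumes "lie_subalgebra L"
  shows "lie_subalgebra (derived_algebra L)" and "derived_algebra L \<subseteq> L"
proof -
  let ?F = "{M. (lie_subalgebra M \<and> M \<subseteq> L) \<and> {lie_bracket D E | D E. D \<in> L \<and> E \<in> L} \<subseteq> M}"
  have eq: "derived_algebra L = \<Inter>?F" by (simp add: derived_algebra_def hull_def)
  have L: "L \<in> ?F" using assms by (auto simp: lie_subalgebra_def)
  show "lie_subalgebra (derived_algebra L)"
    unfolding eq by (rule lie_subalgebra_Inter) (use L in blast)+
  show "derived_algebra L \<subseteq> L" unfolding eq using L by (rule Inter_lower)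
qed

end

end

theory Submission
  imports Defs "HOL-Library.Function_Algebras"
begin

text \<open>
  Everything reduces to the passage from \<open>L'\<close> to \<open>L\<close>, because a solvable \<open>L\<close> has a term of its
  derived series equal to zero, and zero is weakly locally finite.

  So let \<open>L'\<close> be weakly locally finite. The elements of a finite subset of \<open>L\<close> are adjoined one
  at a time to finite subsets of \<open>L'\<close>. Two facts make a single adjunction of \<open>D\<close> possible.

  First, a locally finite \<open>D\<close> can be added to a locally finite set \<open>S\<close> as soon as \<open>[D, s]\<close>
  is a combination of elements of \<open>S\<close> for all \<open>s \<in> S\<close> (\<open>locally_finite_insert\<close>): if \<open>U\<close> is
  stable under \<open>D\<close>, then so is the smallest \<open>S\<close>-stable subspace containing \<open>U\<close>, since moving \<open>D\<close>
  to the right through a word in \<open>S\<close> costs only further words in \<open>S\<close>.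

  Second, a finite set can be enlarged to a finite one with this property, because \<open>ad D\<close> is itself
  locally finite on derivations (\<open>ad_iterates_dependent\<close>). This is where derivation-finiteness
  enters. A derivation is determined by its values on a finite set \<open>F\<close>; put \<open>F\<close> in a
  finite-dimensional \<open>D\<close>-stable subspace \<open>U\<close>, and \<open>E U\<close> in a finite-dimensional \<open>D\<close>-stable
  subspace \<open>W\<close>. All \<open>(ad D)\<^sup>i E\<close> map \<open>U\<close> into \<open>W\<close>, so they live in a space that embeds
  into the finite-dimensional space \<open>W\<^sup>F\<close>.

  Brackets with elements of \<open>L\<close> land in \<open>L'\<close>, and \<open>L'\<close> is stable under \<open>ad D\<close>, so each
  enlargement only adds elements of \<open>L'\<close>.
\<close>

section \<open>Linear dependence of sequences of functions\<close>

context vector_space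
begin

lemma span_image_eq_sum:
  assumes "finite I" and "h \<in> span (g ` I)"
  obtains c where "h = (\<Sum>i\<in>I. c i *s g i)"
proof -
  let ?P = "\<lambda>h. \<exists>c. h = (\<Sum>i\<in>I. c i *s g i)"
  have "?P h"
  proof (rule span_induct[OF assms(2)])
    show "subspace {h. ?P h}"
    proof (rule subspaceI)
      show "0 \<in> {h. ?P h}"
        by (auto intro!: exI[of _ "\<lambda>_. 0"])
    next
      fix x y assume "x \<in> {h. ?P h}" "y \<in> {h. ?P h}"
      then obtain c d where "x = (\<Sum>i\<in>I. c i *s g i)" "y = (\<Sum>i\<in>I. d i *s g i)" by blast
      then have "x + y = (\<Sum>i\<in>I. (c i + d i) *s g i)"
        by (simp add: scale_left_distrib sum.distrib)
      then show "x + y \<in> {h. ?P h}" by auto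
    next
      fix a x assume "x \<in> {h. ?P h}"
      then obtain c where "x = (\<Sum>i\<in>I. c i *s g i)" by blast
      then have "a *s x = (\<Sum>i\<in>I. (a * c i) *s g i)" by (simp add: scale_sum_right)
      then show "a *s x \<in> {h. ?P h}" by auto
    qed
  next
    fix x assume "x \<in> g ` I"
    then obtain j where j: "j \<in> I" "x = g j" by blast
    have "(\<Sum>i\<in>I. (if i = j then 1 else 0) *s g i) = (\<Sum>i\<in>I. if i = j then g i else 0)"
      by (rule sum.cong) auto
    also have "\<dots> = g j" using j assms(1) by simp
    finally show "?P x" using j by (intro exI[of _ "\<lambda>i. if i = j then 1 else 0"]) simp
  qed
  then show ?thesis using that by blast
qed

lemma sequence_dependent:
  fixes g :: "nat \<Rightarrow> 'b"
  assumes "finite T" and "\<And>i. g i \<in> span T"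
  obtains n c where "g n = (\<Sum>i<n. c i *s g i)"
proof -
  have "\<exists>n. g n \<in> span (g ` {..<n})"
  proof (rule ccontr)
    assume "\<nexists>n. g n \<in> span (g ` {..<n})"
    then have new: "g n \<notin> span (g ` {..<n})" for n by blast
    have indep: "independent (g ` {..<n}) \<and> card (g ` {..<n}) = n" for n
    proof (induction n)
      case (Suc n)
      have "g n \<notin> g ` {..<n}" using new[of n] span_base[of "g n" "g ` {..<n}"] by blast
      moreover have "independent (insert (g n) (g ` {..<n}))"
        using new[of n] Suc.IH by (intro independent_insertI) simp_all
      ultimately show ?case using Suc.IH by (simp add: lessThan_Suc)
    qed (simp add: independent_empty)
    have "g ` {..<Suc (card T)} \<subseteq> span T" using assms(2) by (rule image_subsetI)
    with assms(1) indep[of "Suc (card T)", THEN conjunct1]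
    have "card (g ` {..<Suc (card T)}) \<le> card T" by (rule independent_span_bound[THEN conjunct2])
    then show False using indep[of "Suc (card T)", THEN conjunct2] by (simp only: not_less_eq_eq)
  qed
  then obtain n where "g n \<in> span (g ` {..<n})" by (rule exE)
  then show ?thesis using span_image_eq_sum[OF finite_lessThan] that by metis
qed

text \<open>The space of functions from a finite set \<open>F\<close> to a space spanned by a finite set \<open>T\<close> is itself
  finite-dimensional: it is spanned by the functions concentrated at one point of \<open>F\<close>, with value
  in \<open>T\<close>.\<close>

lemma function_sequence_dependent:
  fixes g :: "nat \<Rightarrow> 'x \<Rightarrow> 'b"
  assumes "finite F" and "finite T" and g: "\<And>i x. x \<in> F \<Longrightarrow> g i x \<in> span T"
  obtains n c where "\<And>x. x \<in> F \<Longrightarrow> g n x = (\<Sum>i<n. c i *s g i x)"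
proof -
  interpret fn: vector_space "\<lambda>c (h :: 'x \<Rightarrow> 'b) x. c *s h x"
    by unfold_locales (auto simp: fun_eq_iff scale_right_distrib scale_left_distrib)
  define point where "point a t = (\<lambda>x :: 'x. if x = a then t else (0 :: 'b))" for a t
  let ?S = "(\<lambda>(a, t). point a t) ` (F \<times> T)"
  have point_span: "point a w \<in> fn.span ?S" if "a \<in> F" "w \<in> span T" for a w
    using that(2)
  proof (induction rule: span_induct_alt)
    case base
    have "point a 0 = 0" by (auto simp: point_def)
    then show ?case using fn.span_zero by (simp only:)
  next
    case (step c t y)
    have "point a (c *s t + y) = (\<lambda>x. c *s point a t x) + point a y"
      by (auto simp: point_def fun_eq_iff)
    moreover have "point a t \<in> fn.span ?S"
      using that(1) step(1) by (intro fn.span_base) auto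
    ultimately show ?case using step(2) by (simp only: fn.span_add fn.span_scale)
  qed
  define r where "r i x = (if x \<in> F then g i x else 0)" for i x
  have "r i = (\<Sum>a\<in>F. point a (g i a))" for i
  proof
    fix x
    have "(\<Sum>a\<in>F. point a (g i a)) x = (\<Sum>a\<in>F. point a (g i a) x)"
      using assms(1) by (induction F rule: finite_induct) auto
    also have "\<dots> = r i x" using assms(1) by (simp add: point_def r_def)
    finally show "r i x = (\<Sum>a\<in>F. point a (g i a)) x" by simp
  qed
  then have "r i \<in> fn.span ?S" for i
    using point_span g by (simp add: fn.span_sum)
  then obtain n c where rn: "r n = (\<Sum>i<n. (\<lambda>x. c i *s r i x))"
    using fn.sequence_dependent[of ?S r] assms(1,2) by blast
  have sum_apply: "(\<Sum>i<m. (\<lambda>x. c i *s r i x)) x = (\<Sum>i<m. c i *s r i x)" for m x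
    by (induction m) auto
  have "g n x = (\<Sum>i<n. c i *s g i x)" if "x \<in> F" for x
    using fun_cong[OF rn, of x] that unfolding sum_apply by (simp add: r_def)
  then show ?thesis using that by blast
qed

end

context nonassoc_algebra
begin

section \<open>Finite-dimensional stable subspaces\<close>

lemma finite_dim_subspace_mono:
  assumes "subspace U" and "U \<subseteq> W" and "finite_dim_subspace W"
  shows "finite_dim_subspace U"
proof -
  obtain T where T: "finite T" "span T = W"
    using assms(3) by (auto simp: finite_dim_subspace_def)
  obtain B where B: "B \<subseteq> U" "independent B" "U \<subseteq> span B"
    using maximal_independent_subset by blast
  have "finite B" using independent_span_bound[OF T(1) B(2)] B(1) assms(2) T(2) by blast
  moreover have "span B = U" using B assms(1) by (metis span_subspace)
  ultimately show ?thesis using assms(1) by (auto simp: finite_dim_subspace_def)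
qed

lemma Der_image_span_subset:
  assumes "D \<in> Der" and "D ` T \<subseteq> span T"
  shows "D ` span T \<subseteq> span T"
proof -
  interpret D: Vector_Spaces.linear scale scale D using assms(1) by (simp add: Der_def)
  have "D ` span T = span (D ` T)" by (simp add: D.span_image)
  also have "\<dots> \<subseteq> span T" using assms(2) by (simp add: span_minimal)
  finally show ?thesis .
qed

lemma locally_finite_finite_subset:
  assumes "locally_finite \<Delta>" and "\<Delta> \<subseteq> Der" and "finite T"
  obtains U where "finite_dim_subspace U" "T \<subseteq> U" "\<And>D. D \<in> \<Delta> \<Longrightarrow> D ` U \<subseteq> U"
proof -
  have "\<exists>U. finite_dim_subspace U \<and> T \<subseteq> U \<and> (\<forall>D\<in>\<Delta>. D ` U \<subseteq> U)"
    using assms(3)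
  proof (induction T rule: finite_induct)
    case empty
    show ?case using assms(1) unfolding locally_finite_def by blast
  next
    case (insert b T)
    obtain U where U: "finite_dim_subspace U" "T \<subseteq> U" "\<forall>D\<in>\<Delta>. D ` U \<subseteq> U"
      using insert.IH by blast
    obtain V where V: "finite_dim_subspace V" "b \<in> V" "\<forall>D\<in>\<Delta>. D ` V \<subseteq> V"
      using assms(1) unfolding locally_finite_def by blast
    obtain S1 S2 where S: "finite S1" "span S1 = U" "finite S2" "span S2 = V"
      using U(1) V(1) by (auto simp: finite_dim_subspace_def)
    have sub: "U \<union> V \<subseteq> span (S1 \<union> S2)"
      using S by (metis Un_least span_mono Un_upper1 Un_upper2)
    have "D ` span (S1 \<union> S2) \<subseteq> span (S1 \<union> S2)" if "D \<in> \<Delta>" for D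
    proof (rule Der_image_span_subset)
      show "D \<in> Der" using that assms(2) by blast
      have "D ` (S1 \<union> S2) \<subseteq> D ` (U \<union> V)" using S span_superset by blast
      also have "\<dots> \<subseteq> U \<union> V" using that U(3) V(3) by blast
      finally show "D ` (S1 \<union> S2) \<subseteq> span (S1 \<union> S2)" using sub by blast
    qed
    moreover have "finite_dim_subspace (span (S1 \<union> S2))"
      using S by (auto simp: finite_dim_subspace_def)
    moreover have "insert b T \<subseteq> span (S1 \<union> S2)" using sub U(2) V(2) by blast
    ultimately show ?case by blast
  qed
  then show ?thesis using that by blast
qed

lemma LFD_finite_subset:
  assumes "D \<in> LFD" and "finite T"
  obtains U where "finite_dim_subspace U" "T \<subseteq> U" "D ` U \<subseteq> U"
proof -
  have "locally_finite {D}" "{D} \<subseteq> Der" using assms(1) by (auto simp: LFD_def)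
  from locally_finite_finite_subset[OF this assms(2)] that show ?thesis by (metis singletonI)
qed

text \<open>Let \<open>H\<close> be the smallest \<open>S\<close>-stable subspace containing a given \<open>D\<close>-stable \<open>U\<close>. The set of
  \<open>w \<in> H\<close> with \<open>D w \<in> H\<close> is again an \<open>S\<close>-stable subspace containing \<open>U\<close>, since
  \<open>D (s w) = s (D w) + [D, s] w\<close>; so it is all of \<open>H\<close>. The hypothesis on brackets is only asked for
  at each vector, which allows a combination of elements of \<open>S\<close> whose coefficients
  depend on the vector.\<close>

lemma locally_finite_insert:
  assumes D: "D \<in> LFD" and S: "S \<subseteq> Der" "locally_finite S"
    and bracket: "\<And>s x. s \<in> S \<Longrightarrow> lie_bracket D s x \<in> span ((\<lambda>t. t x) ` S)"
  shows "locally_finite (insert D S)"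
  unfolding locally_finite_def
proof
  fix b
  have DD: "D \<in> Der" "locally_finite {D}" using D by (auto simp: LFD_def)
  obtain U where U: "finite_dim_subspace U" "b \<in> U" "D ` U \<subseteq> U"
    using DD(2) unfolding locally_finite_def by auto
  obtain T where T: "finite T" "span T = U" using U(1) by (auto simp: finite_dim_subspace_def)
  obtain W where W: "finite_dim_subspace W" "T \<subseteq> W" "\<And>s. s \<in> S \<Longrightarrow> s ` W \<subseteq> W"
    using locally_finite_finite_subset[OF S(2,1) T(1)] by blast
  have UW: "U \<subseteq> W" using W(1,2) T(2) span_minimal by (auto simp: finite_dim_subspace_def)
  define stable where "stable V \<longleftrightarrow> subspace V \<and> (\<forall>s\<in>S. s ` V \<subseteq> V)" for V
  define H where "H = stable hull U"
  have Inter: "stable (\<Inter>\<V>)" if "\<And>V. V \<in> \<V> \<Longrightarrow> stable V" for \<V>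
    using that unfolding stable_def by (fastforce intro: subspace_Inter)
  then have "stable H" unfolding H_def by (rule hull_in) (use Inter in blast)
  then have H: "subspace H" "\<And>s w. s \<in> S \<Longrightarrow> w \<in> H \<Longrightarrow> s w \<in> H"
    unfolding stable_def by auto
  have UH: "U \<subseteq> H" unfolding H_def by (rule hull_subset)
  have HW: "H \<subseteq> W"
    unfolding H_def using UW W(1,3) by (intro hull_minimal) (auto simp: stable_def finite_dim_subspace_def)
  let ?N = "{w \<in> H. D w \<in> H}"
  have "H \<subseteq> ?N"
    unfolding H_def
  proof (rule hull_minimal, fold H_def)
    show "U \<subseteq> ?N" using UH U(3) by blast
    have "subspace ?N"
      using H(1) DerD[OF DD(1)] by (auto simp: subspace_def)
    moreover have "s w \<in> ?N" if "s \<in> S" "w \<in> ?N" for s w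
    proof -
      have "(\<lambda>t. t w) ` S \<subseteq> H" using H(2) that(2) by auto
      then have "span ((\<lambda>t. t w) ` S) \<subseteq> H" using H(1) by (rule span_minimal)
      then have "lie_bracket D s w \<in> H" using bracket[OF that(1)] by blast
      moreover have "D (s w) = s (D w) + lie_bracket D s w" by (simp add: lie_bracket_def)
      ultimately have "D (s w) \<in> H" using H that by (simp add: subspace_add)
      then show ?thesis using H(2) that by simp
    qed
    ultimately show "stable ?N" unfolding stable_def by blast
  qed
  then have "\<forall>E\<in>insert D S. E ` H \<subseteq> H" using H(2) by auto
  moreover have "finite_dim_subspace H" by (rule finite_dim_subspace_mono[OF H(1) HW W(1)])
  ultimately show "\<exists>U. finite_dim_subspace U \<and> b \<in> U \<and> (\<forall>E\<in>insert D S. E ` U \<subseteq> U)"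
    using UH U(2) by blast
qed

section \<open>The adjoint action of a locally finite derivation\<close>

lemma Der_sum:
  assumes "finite I" and "\<And>i. i \<in> I \<Longrightarrow> g i \<in> Der"
  shows "(\<lambda>x. \<Sum>i\<in>I. c i *s g i x) \<in> Der"
  using assms
proof (induction I rule: finite_induct)
  case empty
  then show ?case using lie_subalgebra_Der by (simp add: lie_subalgebra_def)
next
  case (insert i I)
  then show ?case using lie_subalgebra_Der by (simp add: lie_subalgebra_def)
qed

lemma derivation_finite_eqI:
  assumes "\<And>D. D \<in> Der \<Longrightarrow> (\<forall>x\<in>F. D x = 0) \<Longrightarrow> D = (\<lambda>_. 0)"
    and "D \<in> Der" "E \<in> Der" and "\<And>x. x \<in> F \<Longrightarrow> D x = E x"
  shows "D = E"
proof -
  have "(\<lambda>x. D x + (- 1) *s E x) \<in> Der"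
    using lie_subalgebra_Der assms(2,3) by (simp add: lie_subalgebra_def del: scale_minus_left)
  then have "(\<lambda>x. D x + (- 1) *s E x) = (\<lambda>_. 0)" using assms(1,4) by simp
  then show ?thesis by (simp add: fun_eq_iff)
qed

lemma ad_iterates_mem:
  assumes "\<And>E. E \<in> M \<Longrightarrow> lie_bracket D E \<in> M" and "E \<in> M"
  shows "(lie_bracket D ^^ i) E \<in> M"
  using assms by (induction i) auto

text \<open>The relation is first found on a finite set that determines derivations, where it holds
  because the iterates take values in one finite-dimensional space; it then holds everywhere because
  both sides are derivations.\<close>

lemma ad_iterates_dependent:
  assumes "derivation_finite" and D: "D \<in> LFD" and E: "E \<in> Der"
  obtains n c where "\<And>x. (lie_bracket D ^^ n) E x = (\<Sum>i<n. c i *s (lie_bracket D ^^ i) E x)"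
proof -
  have DD: "D \<in> Der" using D by (simp add: LFD_def)
  obtain F where F: "finite F" "\<And>D. D \<in> Der \<Longrightarrow> (\<forall>x\<in>F. D x = 0) \<Longrightarrow> D = (\<lambda>_. 0)"
    using assms(1) unfolding derivation_finite_def by blast
  obtain U where U: "finite_dim_subspace U" "F \<subseteq> U" "D ` U \<subseteq> U"
    using LFD_finite_subset[OF D F(1)] .
  obtain T where T: "finite T" "span T = U" using U(1) by (auto simp: finite_dim_subspace_def)
  obtain W where W: "finite_dim_subspace W" "E ` T \<subseteq> W" "D ` W \<subseteq> W"
    using LFD_finite_subset[OF D finite_imageI[OF T(1)]] .
  obtain R where R: "finite R" "span R = W" using W(1) by (auto simp: finite_dim_subspace_def)
  interpret E: Vector_Spaces.linear scale scale E using E by (simp add: Der_def)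
  have "E ` U = span (E ` T)" using T(2) E.span_image by simp
  also have "\<dots> \<subseteq> W" using W(1,2) span_minimal by (auto simp: finite_dim_subspace_def)
  finally have EU: "E ` U \<subseteq> W" .
  let ?g = "\<lambda>i. (lie_bracket D ^^ i) E"
  have g_range: "?g i x \<in> W" if "x \<in> U" for i x
  proof -
    have "?g i \<in> {h. \<forall>x\<in>U. h x \<in> W}"
    proof (rule ad_iterates_mem)
      fix h assume "h \<in> {h. \<forall>x\<in>U. h x \<in> W}"
      then show "lie_bracket D h \<in> {h. \<forall>x\<in>U. h x \<in> W}"
        using U(3) W(1,3) by (auto simp: lie_bracket_def finite_dim_subspace_def intro!: subspace_diff)
    qed (use EU in auto)
    then show ?thesis using that by blast
  qed
  obtain n c where c: "\<And>x. x \<in> F \<Longrightarrow> ?g n x = (\<Sum>i<n. c i *s ?g i x)"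
    using function_sequence_dependent[OF F(1) R(1), of ?g] g_range R(2) U(2) by blast
  have g_Der: "?g i \<in> Der" for i
    using lie_subalgebra_Der DD E by (intro ad_iterates_mem) (auto simp: lie_subalgebra_def)
  have "?g n = (\<lambda>x. \<Sum>i<n. c i *s ?g i x)"
    by (rule derivation_finite_eqI[OF F(2)]) (auto simp: g_Der c intro!: Der_sum)
  then show ?thesis by (intro that[of n c]) (rule fun_cong)
qed

text \<open>The finite set produced here consists of the first few iterates of \<open>ad D\<close> on each element
  of \<open>G\<close>.\<close>

lemma finite_ad_stable_extension:
  assumes "derivation_finite" and D: "D \<in> LFD" and G: "finite G" "G \<subseteq> M" and M: "M \<subseteq> Der"
    and ad: "\<And>E. E \<in> M \<Longrightarrow> lie_bracket D E \<in> M"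
  obtains S where "finite S" "G \<subseteq> S" "S \<subseteq> M"
    "\<And>s x. s \<in> S \<Longrightarrow> lie_bracket D s x \<in> span ((\<lambda>t. t x) ` S)"
proof -
  let ?it = "\<lambda>E i. (lie_bracket D ^^ i) E"
  have "\<exists>n. \<forall>x. ?it E n x \<in> span ((\<lambda>i. ?it E i x) ` {..<n})" if "E \<in> G" for E
  proof -
    have "E \<in> Der" using that G(2) M by blast
    then obtain n c where c: "\<And>x. ?it E n x = (\<Sum>i<n. c i *s ?it E i x)"
      using ad_iterates_dependent[OF assms(1) D] by blast
    have "?it E n x \<in> span ((\<lambda>i. ?it E i x) ` {..<n})" for x
      unfolding c[of x] by (intro span_sum span_scale span_base imageI) simp
    then show ?thesis by blast
  qed
  then obtain n where n: "\<And>E x. E \<in> G \<Longrightarrow> ?it E (n E) x \<in> span ((\<lambda>i. ?it E i x) ` {..<n E})"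
    by metis
  \<comment> \<open>\<open>G\<close> is added because \<open>n E = 0\<close> leaves no iterate of \<open>E\<close>; this happens only for \<open>E = 0\<close>.\<close>
  define S where "S = G \<union> (\<Union>E\<in>G. ?it E ` {..<n E})"
  have iterate: "lie_bracket D (?it E i) x \<in> span ((\<lambda>t. t x) ` S)" if "E \<in> G" "i < n E" for E i x
  proof (cases "Suc i = n E")
    case True
    have "(\<lambda>i. ?it E i x) ` {..<n E} \<subseteq> (\<lambda>t. t x) ` S" using that(1) by (auto simp: S_def)
    then have "?it E (n E) x \<in> span ((\<lambda>t. t x) ` S)" using n[OF that(1)] span_mono by blast
    then show ?thesis using True by (metis funpow.simps(2) o_apply)
  next
    case False
    then have "?it E (Suc i) \<in> S" using that unfolding S_def
      by (intro UnI2 UN_I[OF that(1)] imageI) simp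
    then have "?it E (Suc i) x \<in> span ((\<lambda>t. t x) ` S)" by (intro span_base imageI)
    then show ?thesis by simp
  qed
  have "lie_bracket D s x \<in> span ((\<lambda>t. t x) ` S)" if "s \<in> S" for s x
  proof (cases "s \<in> G")
    case True
    show ?thesis
    proof (cases "n s = 0")
      case True
      have "D \<in> Der" using D by (simp add: LFD_def)
      moreover have "s y = 0" for y using n[OF \<open>s \<in> G\<close>, of y] True by simp
      ultimately show ?thesis by (simp add: lie_bracket_def DerD span_zero)
    next
      case False
      then show ?thesis using iterate[OF True, of 0] by simp
    qed
  next
    case False
    then show ?thesis using that iterate unfolding S_def by blast
  qed
  moreover have "finite S" using G(1) by (simp add: S_def)
  moreover have "G \<subseteq> S" by (simp add: S_def)
  moreover have "S \<subseteq> M" using ad_iterates_mem[of M D, OF ad] G(2) unfolding S_def by blast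
  ultimately show ?thesis using that by blast
qed

section \<open>From the derived algebra to the algebra\<close>

lemma bracket_in_derived_algebra:
  assumes "D \<in> L" "E \<in> L"
  shows "lie_bracket D E \<in> derived_algebra L"
  unfolding derived_algebra_def using assms by (intro set_mp[OF hull_subset]) blast

text \<open>The statement is about \<open>F \<union> G\<close>, with \<open>G\<close> an arbitrary finite part of \<open>L'\<close>, so that induction
  on \<open>F\<close> can feed it a larger \<open>G\<close>: the one which absorbs the brackets of the new derivation
  with \<open>F\<close> and with \<open>G\<close>.\<close>

lemma locally_finite_Un_derived:
  assumes fin: "derivation_finite" and L: "lie_subalgebra L" "L \<subseteq> LFD"
    and wlf: "weakly_locally_finite (derived_algebra L)"
    and F: "finite F" "F \<subseteq> L" and G: "finite G" "G \<subseteq> derived_algebra L"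
  shows "locally_finite (F \<union> G)"
  using F G
proof (induction F arbitrary: G rule: finite_induct)
  case empty
  then show ?case using wlf by (simp add: weakly_locally_finite_def)
next
  case (insert D F)
  note sub = derived_algebra_lie_subalgebra(2)[OF L(1)]
  have LDer: "L \<subseteq> Der" using L(1) by (simp add: lie_subalgebra_def)
  have D: "D \<in> L" "D \<in> LFD" using insert.prems L(2) by auto
  let ?G = "G \<union> lie_bracket D ` F"
  have G: "finite ?G" "?G \<subseteq> derived_algebra L"
    using insert.prems insert.hyps D(1) by (auto intro: bracket_in_derived_algebra)
  have M: "derived_algebra L \<subseteq> Der" using sub LDer by blast
  have ad_M: "lie_bracket D E \<in> derived_algebra L" if "E \<in> derived_algebra L" for E
    using that sub D(1) by (blast intro: bracket_in_derived_algebra)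
  obtain S where S: "finite S" "?G \<subseteq> S" "S \<subseteq> derived_algebra L"
    and ad: "\<And>s x. s \<in> S \<Longrightarrow> lie_bracket D s x \<in> span ((\<lambda>t. t x) ` S)"
    using finite_ad_stable_extension[OF fin D(2) G M ad_M] by metis
  have "locally_finite (insert D (F \<union> S))"
  proof (rule locally_finite_insert[OF D(2)])
    show "F \<union> S \<subseteq> Der" using insert.prems S(3) sub LDer by blast
    show "locally_finite (F \<union> S)" using insert S by simp
    show "lie_bracket D s x \<in> span ((\<lambda>t. t x) ` (F \<union> S))" if "s \<in> F \<union> S" for s x
    proof (cases "s \<in> S")
      case True
      have "(\<lambda>t. t x) ` S \<subseteq> (\<lambda>t. t x) ` (F \<union> S)" by blast
      then show ?thesis using ad[OF True] span_mono by blast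
    next
      case False
      then have "lie_bracket D s \<in> F \<union> S" using that S(2) by blast
      then show ?thesis by (intro span_base imageI)
    qed
  qed
  moreover have "insert D F \<union> G \<subseteq> insert D (F \<union> S)" using S(2) by blast
  ultimately show ?case unfolding locally_finite_def by (meson subsetD)
qed

lemma weakly_locally_finite_of_derived_algebra:
  assumes "derivation_finite" and "lie_subalgebra L" "L \<subseteq> LFD"
    and "weakly_locally_finite (derived_algebra L)"
  shows "weakly_locally_finite L"
  using locally_finite_Un_derived[OF assms, where G = "{}"]
  by (simp add: weakly_locally_finite_def)

lemma weakly_locally_finite_of_derived_series:
  assumes fin: "derivation_finite" and L: "lie_subalgebra L" "L \<subseteq> LFD"
    and wlf: "weakly_locally_finite (derived_series L n)"
  shows "weakly_locally_finite L"
  using wlf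
proof (induction n)
  case (Suc n)
  have sub: "lie_subalgebra (derived_series L n) \<and> derived_series L n \<subseteq> L"
  proof (induction n)
    case (Suc n)
    then show ?case using derived_algebra_lie_subalgebra[of "derived_series L n"] by auto
  qed (use L in simp)
  have "weakly_locally_finite (derived_series L n)"
  proof (rule weakly_locally_finite_of_derived_algebra[OF fin])
    show "derived_series L n \<subseteq> LFD" using sub L(2) by blast
    show "weakly_locally_finite (derived_algebra (derived_series L n))" using Suc.prems by simp
  qed (use sub in blast)
  then show ?case by (rule Suc.IH)
qed simp

lemma weakly_locally_finite_zero: "weakly_locally_finite {\<lambda>_. 0}"
  unfolding weakly_locally_finite_def locally_finite_def
proof (intro allI impI)
  fix F b assume F: "finite F \<and> F \<subseteq> {\<lambda>_ :: 'b. 0 :: 'b}"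
  have "finite_dim_subspace (span {b})" unfolding finite_dim_subspace_def by blast
  moreover have "D ` span {b} \<subseteq> span {b}" if "D \<in> F" for D
    using F that by (auto simp: span_zero)
  ultimately show "\<exists>U. finite_dim_subspace U \<and> b \<in> U \<and> (\<forall>D\<in>F. D ` U \<subseteq> U)"
    using span_base[of b "{b}"] by blast
qed

end

theorem corollary1:
  fixes scale :: "'k::field \<Rightarrow> 'b::ab_group_add \<Rightarrow> 'b"
    and mult :: "'b \<Rightarrow> 'b \<Rightarrow> 'b"
    and L :: "('b \<Rightarrow> 'b) set"
  assumes "nonassoc_algebra scale mult"
    and "nonassoc_algebra.derivation_finite scale mult"
    and "nonassoc_algebra.lie_subalgebra scale mult L"
    and "L \<subseteq> nonassoc_algebra.LFD scale mult"
  shows "((\<exists>n. nonassoc_algebra.weakly_locally_finite scale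
                 (nonassoc_algebra.derived_series scale mult L n))
            \<longrightarrow> nonassoc_algebra.weakly_locally_finite scale L)
       \<and> (nonassoc_algebra.lie_solvable scale mult L
            \<longrightarrow> nonassoc_algebra.weakly_locally_finite scale L)"
proof -
  interpret nonassoc_algebra scale mult by (rule assms(1))
  have series: "weakly_locally_finite (derived_series L n) \<Longrightarrow> weakly_locally_finite L" for n
    using assms(2-4) by (rule weakly_locally_finite_of_derived_series)
  moreover have "weakly_locally_finite L" if solvable: "lie_solvable L"
  proof -
    obtain d where "derived_series L d = {\<lambda>_. 0}"
      using solvable unfolding lie_solvable_def by blast
    then show ?thesis using series[of d] weakly_locally_finite_zero by simp
  qed
  ultimately show ?thesis by blast
qed

end
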